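(* Let $n\ge1$ and $D\ge 1$ be integers, $0\le p<1$, $q=1-p$, and let $I\sim\mathcal{I}(n,D,p)$ be an Erdős--Rényi random monomial ideal in $S=\mathbb{k}[x_1,\ldots,x_n]$. For every integer $d$ with $1<d\le D$, the expectation of $h_d=\dim_{\mathbb{k}}[S/(I+\langle x_1,\ldots,x_n\rangle^{D+1})]_d$ is $$\mathbb{E}[h_d]=q^{-1}\cdot\sum_{\substack{a\in\mathbb{N}_0^n\\ |a|=d}} q^{(a_1+1)\cdots(a_n+1)}.$$
   Context: $\mathbb{k}$ is an infinite field and $S$ has the standard grading $\deg x_i=1$. The distribution $\mathcal{I}(n,D,p)$: form a random set $B$ of monomials by including, independently and each with probability $p$, every non-constant monomial in $x_1,\ldots,x_n$ of total degree at most $D$; then $I=\langle B\rangle$, with $I=\langle 0\rangle$ if $B=\emptyset$. For $a=(a_1,\ldots,a_n)\in\mathbb{N}_0^n$, $|a|=a_1+\cdots+a_n$. *)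

theory Defs
  imports
    "HOL-Probability.Probability"
    "HOL-Library.Poly_Mapping"
    "HOL-Algebra.Algebraic_Closure_Type"
    "HOL-Algebra.Embedded_Algebras"
    "HOL-Algebra.Ideal_Product"
    "HOL-Algebra.QuotRing"
begin

text \<open>
  The variables of $S = k[x_1, \ldots, x_n]$ are indexed by a finite type \<open>'n\<close>, so that
  $n = $ \<open>CARD('n)\<close> is an arbitrary positive integer. An exponent vector is an element of
  \<open>'n \<Rightarrow>\<^sub>0 nat\<close>, and a polynomial maps exponent vectors to coefficients.
\<close>

type_synonym ('n, 'k) mpoly = "('n \<Rightarrow>\<^sub>0 nat) \<Rightarrow>\<^sub>0 'k"

abbreviation mpoly_ring :: "('n, 'k::field) mpoly ring"
  where "mpoly_ring \<equiv> ring_of_type_algebra"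

definition total_deg :: "('n::finite \<Rightarrow>\<^sub>0 nat) \<Rightarrow> nat"
  where "total_deg a = (\<Sum>i\<in>UNIV. Poly_Mapping.lookup a i)"

definition monomial :: "('n \<Rightarrow>\<^sub>0 nat) \<Rightarrow> ('n, 'k::field) mpoly"
  where "monomial a = Poly_Mapping.single a 1"

definition variable :: "'n \<Rightarrow> ('n, 'k::field) mpoly"
  where "variable i = monomial (Poly_Mapping.single i 1)"

definition constant_poly :: "'k::field \<Rightarrow> ('n, 'k) mpoly"
  where "constant_poly c = Poly_Mapping.single 0 c"

definition homogeneous_polys :: "nat \<Rightarrow> ('n::finite, 'k::field) mpoly set"
  where "homogeneous_polys d = {f. \<forall>a\<in>Poly_Mapping.keys f. total_deg a = d}"

definition irrelevant_ideal :: "('n, 'k::field) mpoly set"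
  where "irrelevant_ideal = genideal mpoly_ring (range variable)"

definition ideal_pow :: "('n, 'k::field) mpoly set \<Rightarrow> nat \<Rightarrow> ('n, 'k) mpoly set"
  where "ideal_pow J e = J [^]\<^bsub>ideals_set mpoly_ring\<^esub> e"

text \<open>
  For a homogeneous ideal \<open>J\<close>, the degree-\<open>d\<close> component of $S/J$ is the image of the space of
  forms of degree \<open>d\<close>. Its dimension is taken over the image of the constants in $S/J$, which is
  a copy of $k$ whenever \<open>J\<close> is proper.
\<close>

definition quotient_map :: "('n, 'k::field) mpoly set \<Rightarrow> ('n, 'k) mpoly \<Rightarrow> ('n, 'k) mpoly set"
  where "quotient_map J f = J +>\<^bsub>mpoly_ring\<^esub> f"

definition graded_quotient_dim :: "('n::finite, 'k::field) mpoly set \<Rightarrow> nat \<Rightarrow> nat"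
  where "graded_quotient_dim J d =
    ring.dim (mpoly_ring Quot J)
      (quotient_map J ` range constant_poly) (quotient_map J ` homogeneous_polys d)"

definition candidate_monomials :: "nat \<Rightarrow> ('n::finite, 'k::field) mpoly set"
  where "candidate_monomials D = monomial ` {a. a \<noteq> 0 \<and> total_deg a \<le> D}"

definition random_monomials :: "nat \<Rightarrow> real \<Rightarrow> ('n::finite, 'k::field) mpoly set pmf"
  where "random_monomials D p =
    map_pmf (\<lambda>included. {m \<in> candidate_monomials D. included m})
      (Pi_pmf (candidate_monomials D) False (\<lambda>_. bernoulli_pmf p))"

text \<open>
  The Erdos--Renyi distribution $\mathcal{I}(n,D,p)$ on ideals. The ideal generated by the empty
  set is the zero ideal.
\<close>

definition ER_monomial_ideal :: "nat \<Rightarrow> real \<Rightarrow> ('n::finite, 'k::field) mpoly set pmf"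
  where "ER_monomial_ideal D p = map_pmf (genideal mpoly_ring) (random_monomials D p)"

end

theory Submission
  imports Defs
begin

text \<open>
  An ideal generated by monomials consists of all polynomials whose monomials lie in a fixed set of
  exponents closed under adding exponents. This turns the whole problem into combinatorics of
  exponents: the random ideal corresponds to the multiples of the chosen exponents
  (\<open>genideal_monomials\<close>), the power of the irrelevant ideal to the exponents of large degree
  (\<open>ideal_pow_irrelevant_ideal\<close>), and the sum of two such ideals to the union of the two sets
  (\<open>set_add_supported_on\<close>). The monomials outside the ideal, called standard, form a basis of the
  quotient (\<open>graded_quotient_dim_supported_on\<close>), so the Hilbert function counts standard monomials
  of degree \<open>d\<close>.

  By linearity of expectation the expected count is the sum, over all exponents \<open>a\<close> of degree \<open>d\<close>,
  of the probability that $x^a$ is standard. Since $d \le D$, the ideal power does not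
  reach degree \<open>d\<close>, and every non-constant divisor of $x^a$ is a candidate generator; $x^a$ is
  standard exactly when none of these is chosen. The monomial has $\prod_i (a_i + 1)$ divisors,
  one of which is constant, and the choices are independent, so the probability is
  $q^{\prod_i (a_i + 1) - 1}$ (\<open>prob_standard_monomial\<close>).
\<close>

section \<open>Monomial ideals as sets of polynomials with prescribed support\<close>

definition supported_on :: "'m set \<Rightarrow> ('m \<Rightarrow>\<^sub>0 'k::zero) set"
  where "supported_on A = {f. Poly_Mapping.keys f \<subseteq> A}"

definition add_closed :: "'m::plus set \<Rightarrow> bool"
  where "add_closed A \<longleftrightarrow> (\<forall>a\<in>A. \<forall>c. a + c \<in> A)"

definition multiples :: "'m::plus set \<Rightarrow> 'm set"
  where "multiples B = {b + c | b c. b \<in> B}"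

lemma add_closed_multiples: "add_closed (multiples (B :: 'm::semigroup_add set))"
  unfolding add_closed_def multiples_def by (auto simp: add.assoc) (metis add.assoc)

lemma mpoly_ring_cring: "cring (mpoly_ring :: ('n, 'k::field) mpoly ring)"
  by (rule cring_from_type_algebra)

lemma mpoly_ring_ring: "ring (mpoly_ring :: ('n, 'k::field) mpoly ring)"
  by (rule ring_from_type_algebra)

lemma mpoly_ring_simps [simp]:
  "carrier mpoly_ring = UNIV"
  "f \<otimes>\<^bsub>mpoly_ring\<^esub> g = f * g"
  "f \<oplus>\<^bsub>mpoly_ring\<^esub> g = f + g"
  "\<zero>\<^bsub>mpoly_ring\<^esub> = 0"
  "\<one>\<^bsub>mpoly_ring\<^esub> = 1"
  by (simp_all add: ring_of_type_algebra_def)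

lemma mpoly_ring_uminus [simp]:
  "\<ominus>\<^bsub>mpoly_ring\<^esub> (f :: ('n, 'k::field) mpoly) = - f"
proof -
  interpret ring "mpoly_ring :: ('n, 'k) mpoly ring" by (rule mpoly_ring_ring)
  show ?thesis
    by (rule minus_equality) simp_all
qed

lemma mpoly_ring_minus [simp]:
  "(f :: ('n, 'k::field) mpoly) \<ominus>\<^bsub>mpoly_ring\<^esub> g = f - g"
  by (simp add: a_minus_def)

lemma supported_on_uminus: "f \<in> supported_on A \<Longrightarrow> - f \<in> supported_on A"
  for f :: "'m \<Rightarrow>\<^sub>0 'k::ab_group_add"
  by (auto simp: supported_on_def in_keys_iff)

text \<open>
  A polynomial is a finite sum of terms. To place all of \<open>supported_on A\<close> inside a set closed
  under addition, it therefore suffices to treat single terms.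
\<close>

lemma supported_on_induct [consumes 1, case_names zero single add]:
  fixes f :: "'m \<Rightarrow>\<^sub>0 'k::comm_monoid_add"
  assumes "f \<in> supported_on A"
    and zero: "P 0"
    and single: "\<And>a c. a \<in> A \<Longrightarrow> P (Poly_Mapping.single a c)"
    and add: "\<And>f g. P f \<Longrightarrow> P g \<Longrightarrow> P (f + g)"
  shows "P f"
proof -
  have "P (\<Sum>a\<in>F. Poly_Mapping.single a (Poly_Mapping.lookup f a))"
    if "finite F" "F \<subseteq> A" for F
    using that by (induction F) (auto intro: zero single add)
  moreover have "f = (\<Sum>a\<in>Poly_Mapping.keys f. Poly_Mapping.single a (Poly_Mapping.lookup f a))"
    by (rule poly_mapping_eqI)
      (auto simp: lookup_sum lookup_single when_def not_in_keys_iff_lookup_eq_zero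
        sum.delta[OF finite_keys])
  ultimately show ?thesis
    using assms(1) by (metis finite_keys mem_Collect_eq supported_on_def)
qed

lemma ideal_supported_on:
  assumes "add_closed A"
  shows "ideal (supported_on A) (mpoly_ring :: ('n, 'k::field) mpoly ring)"
proof (rule idealI)
  interpret R: ring "mpoly_ring :: ('n, 'k) mpoly ring" by (rule mpoly_ring_ring)
  show "ring (mpoly_ring :: ('n, 'k) mpoly ring)" by (rule mpoly_ring_ring)
  show "subgroup (supported_on A) (add_monoid (mpoly_ring :: ('n, 'k) mpoly ring))"
  proof (rule R.add.subgroupI)
    have "(0 :: ('n, 'k) mpoly) \<in> supported_on A"
      by (simp add: supported_on_def)
    then show "supported_on A \<noteq> ({} :: ('n, 'k) mpoly set)" by blast
  next
    fix f :: "('n, 'k) mpoly"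
    assume "f \<in> supported_on A"
    then show "\<ominus>\<^bsub>mpoly_ring\<^esub> f \<in> supported_on A"
      by (simp add: supported_on_uminus)
  next
    fix f g :: "('n, 'k) mpoly"
    assume "f \<in> supported_on A" "g \<in> supported_on A"
    then show "f \<oplus>\<^bsub>mpoly_ring\<^esub> g \<in> supported_on A"
      using keys_add[of f g] by (auto simp: supported_on_def)
  qed simp
  fix f g :: "('n, 'k) mpoly"
  assume "f \<in> supported_on A"
  then have "f * g \<in> supported_on A"
    using keys_mult[of f g] assms unfolding supported_on_def add_closed_def by blast
  then show "g \<otimes>\<^bsub>mpoly_ring\<^esub> f \<in> supported_on A" "f \<otimes>\<^bsub>mpoly_ring\<^esub> g \<in> supported_on A"
    by (simp_all add: mult.commute)
qed

text \<open>
  The right-hand side is an ideal containing the generators; conversely, a term with exponent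
  \<open>b + e\<close> is a multiple of the generator with exponent \<open>b\<close>.
\<close>

lemma genideal_monomials:
  "genideal (mpoly_ring :: ('n, 'k::field) mpoly ring) (monomial ` B) = supported_on (multiples B)"
proof -
  interpret R: ring "mpoly_ring :: ('n, 'k) mpoly ring" by (rule mpoly_ring_ring)
  let ?I = "genideal (mpoly_ring :: ('n, 'k) mpoly ring) (monomial ` B)"
  interpret I: ideal ?I "mpoly_ring :: ('n, 'k) mpoly ring"
    by (rule R.genideal_ideal) simp
  have "b \<in> multiples B" if "b \<in> B" for b
    using that unfolding multiples_def by (metis (mono_tags, lifting) add_0_right mem_Collect_eq)
  then have "?I \<subseteq> supported_on (multiples B)"
    by (intro R.genideal_minimal ideal_supported_on add_closed_multiples)
      (auto simp: supported_on_def monomial_def)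
  moreover have "f \<in> ?I" if "f \<in> supported_on (multiples B)" for f
    using that
  proof (induction rule: supported_on_induct)
    case zero
    show ?case using I.zero_closed by simp
  next
    case (single a c)
    then obtain b e where "b \<in> B" and a: "a = b + e"
      by (auto simp: multiples_def)
    then have "monomial b \<in> ?I"
      using R.genideal_self[of "monomial ` B"] by auto
    then have "Poly_Mapping.single e c * monomial b \<in> ?I"
      using I.I_l_closed[of "monomial b" "Poly_Mapping.single e c"] by simp
    then show ?case
      by (simp add: monomial_def mult_single a add.commute)
  next
    case (add f g)
    then show ?case using I.a_closed[of f g] by simp
  qed
  ultimately show ?thesis by blast
qed

text \<open>
  For the inclusion from right to left, a polynomial is split into the part with exponents in \<open>A\<close>
  and the rest, whose exponents must lie in \<open>B\<close>.
\<close>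

lemma set_add_supported_on:
  "supported_on A <+>\<^bsub>mpoly_ring\<^esub> supported_on B =
    (supported_on (A \<union> B) :: ('n, 'k::field) mpoly set)"
proof
  show "supported_on A <+>\<^bsub>mpoly_ring\<^esub> supported_on B \<subseteq>
      (supported_on (A \<union> B) :: ('n, 'k) mpoly set)"
  proof
    fix h :: "('n, 'k) mpoly"
    assume "h \<in> supported_on A <+>\<^bsub>mpoly_ring\<^esub> supported_on B"
    then obtain f g where "f \<in> supported_on A" "g \<in> supported_on B" "h = f + g"
      by (auto simp: set_add_def')
    then show "h \<in> supported_on (A \<union> B)"
      using keys_add[of f g] by (auto simp: supported_on_def)
  qed
  show "(supported_on (A \<union> B) :: ('n, 'k) mpoly set) \<subseteq>
      supported_on A <+>\<^bsub>mpoly_ring\<^esub> supported_on B"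
  proof
    fix h :: "('n, 'k) mpoly"
    assume h: "h \<in> supported_on (A \<union> B)"
    define f where "f = Poly_Mapping.mapp (\<lambda>a c. if a \<in> A then c else 0) h"
    have f: "Poly_Mapping.lookup f a = (if a \<in> A then Poly_Mapping.lookup h a else 0)" for a
      by (auto simp: f_def lookup_mapp when_def in_keys_iff)
    have "f \<in> supported_on A"
      by (auto simp: supported_on_def in_keys_iff f split: if_splits)
    moreover have "h - f \<in> supported_on B"
      using h by (auto simp: supported_on_def in_keys_iff f lookup_minus split: if_splits)
    moreover have "h = f + (h - f)" by simp
    ultimately show "h \<in> supported_on A <+>\<^bsub>mpoly_ring\<^esub> supported_on B"
      unfolding set_add_def' mpoly_ring_simps by blast
  qed
qed

section \<open>Powers of the irrelevant ideal\<close>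

lemma total_deg_add: "total_deg (a + b) = total_deg a + total_deg b"
  by (simp add: total_deg_def lookup_add sum.distrib)

lemma total_deg_single [simp]: "total_deg (Poly_Mapping.single i e) = e"
  by (simp add: total_deg_def lookup_single when_def)

lemma total_deg_eq_0_iff: "total_deg a = 0 \<longleftrightarrow> a = 0"
  by (auto simp: total_deg_def poly_mapping_eq_iff fun_eq_iff)

text \<open>
  Peeling off a variable drives the induction on the power of the irrelevant ideal.
\<close>

lemma total_deg_Suc_split:
  assumes "Suc e \<le> total_deg a"
  obtains b i where "a = b + Poly_Mapping.single i 1" "e \<le> total_deg b"
proof -
  obtain i where "Poly_Mapping.lookup a i \<noteq> 0"
    using assms by (metis not_less_eq_eq total_deg_def sum.neutral zero_le)
  then have "a = (a - Poly_Mapping.single i 1) + Poly_Mapping.single i 1"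
    by (intro poly_mapping_eqI) (auto simp: lookup_add lookup_minus lookup_single when_def)
  moreover from this have "e \<le> total_deg (a - Poly_Mapping.single i 1)"
    using assms by (metis Suc_eq_plus1 Suc_le_mono total_deg_add total_deg_single)
  ultimately show ?thesis using that by blast
qed

lemma irrelevant_ideal_eq:
  "(irrelevant_ideal :: ('n::finite, 'k::field) mpoly set) = supported_on {a. 1 \<le> total_deg a}"
proof -
  have "multiples (range (\<lambda>i::'n. Poly_Mapping.single i (1::nat))) = {a. 1 \<le> total_deg a}"
  proof (intro Set.set_eqI iffI)
    fix a :: "'n \<Rightarrow>\<^sub>0 nat"
    assume "a \<in> {a. 1 \<le> total_deg a}"
    then obtain b i where "a = Poly_Mapping.single i 1 + b"
      using total_deg_Suc_split[of 0 a] by (metis One_nat_def add.commute mem_Collect_eq)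
    then show "a \<in> multiples (range (\<lambda>i. Poly_Mapping.single i 1))"
      unfolding multiples_def by blast
  qed (auto simp: multiples_def total_deg_add)
  moreover have "range variable = (monomial :: _ \<Rightarrow> ('n, 'k) mpoly) ` range (\<lambda>i::'n. Poly_Mapping.single i (1::nat))"
    by (auto simp: variable_def)
  ultimately show ?thesis
    by (simp only: irrelevant_ideal_def genideal_monomials)
qed

lemma add_closed_total_deg_ge: "add_closed {a. e \<le> total_deg a}"
  by (auto simp: add_closed_def total_deg_add)

text \<open>
  In the induction step, products of polynomials only have exponents of degree at least
  \<open>e + 1\<close>; conversely, each term of such a degree is a term of degree at least \<open>e\<close>
  times a variable.
\<close>

lemma ideal_pow_irrelevant_ideal:
  "ideal_pow (irrelevant_ideal :: ('n::finite, 'k::field) mpoly set) e =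
    supported_on {a. e \<le> total_deg a}"
proof (induction e)
  interpret C: cring "mpoly_ring :: ('n, 'k) mpoly ring" by (rule mpoly_ring_cring)
  interpret S: comm_monoid "ideals_set (mpoly_ring :: ('n, 'k) mpoly ring)"
    by (rule C.ideals_set_is_comm_monoid)
  case 0
  show ?case
    by (simp add: ideal_pow_def) (simp add: ideals_set_def supported_on_def)
next
  interpret C: cring "mpoly_ring :: ('n, 'k) mpoly ring" by (rule mpoly_ring_cring)
  interpret S: comm_monoid "ideals_set (mpoly_ring :: ('n, 'k) mpoly ring)"
    by (rule C.ideals_set_is_comm_monoid)
  case (Suc e)
  let ?P = "ideal_prod mpoly_ring (supported_on {a. e \<le> total_deg a})
    (supported_on {a. 1 \<le> total_deg a}) :: ('n, 'k) mpoly set"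
  have "ideal_pow (irrelevant_ideal :: ('n, 'k) mpoly set) (Suc e) = ?P"
    using Suc.IH by (simp add: ideal_pow_def irrelevant_ideal_eq) (simp add: ideals_set_def)
  also have "?P = supported_on {a. Suc e \<le> total_deg a}"
  proof
    show "?P \<subseteq> supported_on {a. Suc e \<le> total_deg a}"
    proof
      fix h assume "h \<in> ?P"
      then show "h \<in> supported_on {a. Suc e \<le> total_deg a}"
      proof (induction rule: ideal_prod.induct)
        case (prod f g)
        then show ?case
          using keys_mult[of f g] by (fastforce simp: supported_on_def total_deg_add)
      next
        case (sum f g)
        then show ?case
          using keys_add[of f g] by (auto simp: supported_on_def)
      qed
    qed
    show "supported_on {a. Suc e \<le> total_deg a} \<subseteq> ?P"
    proof
      fix h :: "('n, 'k) mpoly"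
      assume "h \<in> supported_on {a. Suc e \<le> total_deg a}"
      then show "h \<in> ?P"
      proof (induction rule: supported_on_induct)
        case zero
        show ?case
          using ideal_prod.prod[of 0 "supported_on {a. e \<le> total_deg a}" 0
              "supported_on {a. 1 \<le> total_deg a}" "mpoly_ring :: ('n, 'k) mpoly ring"]
          by (simp add: supported_on_def)
      next
        case (single a c)
        then obtain b i where "a = b + Poly_Mapping.single i 1" "e \<le> total_deg b"
          by (auto elim: total_deg_Suc_split)
        then show ?case
          using ideal_prod.prod[of "Poly_Mapping.single b c" "supported_on {a. e \<le> total_deg a}"
              "variable i" "supported_on {a. 1 \<le> total_deg a}"
              "mpoly_ring :: ('n, 'k) mpoly ring"]
          by (simp add: supported_on_def variable_def monomial_def mult_single)
      next
        case (add f g)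
        then show ?case
          using ideal_prod.sum[of f "mpoly_ring :: ('n, 'k) mpoly ring"] by simp
      qed
    qed
  qed
  finally show ?case .
qed

section \<open>Standard monomials form a basis\<close>

lemma subfield_constants:
  "subfield (range constant_poly) (mpoly_ring :: ('n, 'k::field) mpoly ring)"
proof -
  interpret F: field "ring_of_type_algebra :: 'k ring" by (rule field_from_type_algebra)
  interpret h: ring_hom_ring "ring_of_type_algebra :: 'k ring"
    "mpoly_ring :: ('n, 'k) mpoly ring" constant_poly
    by (rule ring_hom_ringI2[OF F.ring_axioms mpoly_ring_ring])
      (auto simp: ring_hom_def ring_of_type_algebra_def constant_poly_def mult_single single_add)
  show ?thesis
    using h.img_is_subfield(2)[OF F.carrier_is_subfield]
    by (simp add: ring_of_type_algebra_def)
qed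

text \<open>
  Forms of degree \<open>d\<close> are congruent, modulo the ideal, to combinations of standard monomials. The
  images of the standard monomials are added one at a time to the spanned space. Each new one is
  independent of the others: a difference with a combination of the others still contains its
  exponent, which is not in \<open>A\<close>, so this difference is not in the ideal. The condition \<open>0 \<notin> A\<close>
  says that the ideal is proper, so that the constants embed as a field into the quotient.
\<close>

lemma graded_quotient_dim_supported_on:
  fixes A :: "('n::finite \<Rightarrow>\<^sub>0 nat) set"
  assumes closed: "add_closed A" and "0 \<notin> A" and fin: "finite {a. total_deg a = d \<and> a \<notin> A}"
  shows "graded_quotient_dim (supported_on A :: ('n, 'k::field) mpoly set) d =
    card {a. total_deg a = d \<and> a \<notin> A}"
proof -
  let ?R = "mpoly_ring :: ('n, 'k) mpoly ring"
  let ?J = "supported_on A :: ('n, 'k) mpoly set"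
  let ?h = "quotient_map ?J"
  let ?K = "?h ` range constant_poly"
  interpret R: ring ?R by (rule mpoly_ring_ring)
  interpret J: ideal ?J ?R using closed by (rule ideal_supported_on)
  interpret Q: ring "?R Quot ?J" by (rule J.quotient_is_ring)
  have h_eq: "?h = (\<lambda>f. ?J +>\<^bsub>?R\<^esub> f)"
    by (simp add: quotient_map_def fun_eq_iff)
  interpret h: ring_hom_ring ?R "?R Quot ?J" ?h
    unfolding h_eq by (rule J.rcos_ring_hom_ring)
  have h_eq_iff: "?h f = ?h g \<longleftrightarrow> f - g \<in> ?J" for f g
    using R.quotient_eq_iff_same_a_r_cos[OF J.is_ideal, of f g] by (simp add: h_eq)
  have h_closed: "?h f \<in> carrier (?R Quot ?J)" for f
    by (rule h.hom_closed) simp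
  have h_zero: "?h 0 = \<zero>\<^bsub>?R Quot ?J\<^esub>" and h_one: "?h 1 = \<one>\<^bsub>?R Quot ?J\<^esub>"
    using h.hom_zero h.hom_one by simp_all
  have h_add: "?h f \<oplus>\<^bsub>?R Quot ?J\<^esub> ?h g = ?h (f + g)"
    and h_mult: "?h f \<otimes>\<^bsub>?R Quot ?J\<^esub> ?h g = ?h (f * g)" for f g
    using h.hom_add[of f g] h.hom_mult[of f g] by simp_all
  have "?h 1 \<noteq> ?h 0"
    using \<open>0 \<notin> A\<close> unfolding h_eq_iff by (simp add: supported_on_def)
  then have K: "subfield ?K (?R Quot ?J)"
    by (intro h.img_is_subfield(2) subfield_constants) (simp add: h_zero h_one)
  have dimension: "Q.dimension (card F) ?K (?h ` supported_on F)"
    if "finite F" "F \<inter> A = {}" for F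
    using that
  proof (induction F)
    case empty
    have "supported_on {} = {0 :: ('n, 'k) mpoly}"
      by (auto simp: supported_on_def)
    then show ?case by (simp add: h_zero Q.zero_dim)
  next
    case (insert a F)
    let ?E = "?h ` supported_on F"
    have "?h (monomial a) \<notin> ?E"
    proof
      assume "?h (monomial a) \<in> ?E"
      then obtain f where f: "f \<in> supported_on F" "monomial a - f \<in> ?J"
        by (auto simp: h_eq_iff)
      then have "Poly_Mapping.lookup f a = 0"
        using insert.hyps(2) by (auto simp: supported_on_def in_keys_iff)
      then have "a \<in> Poly_Mapping.keys (monomial a - f)"
        by (simp add: in_keys_iff lookup_minus monomial_def)
      then show False
        using f(2) insert.prems by (auto simp: supported_on_def)
    qed
    moreover have "Q.line_extension ?K (?h (monomial a)) ?E = ?h ` supported_on (insert a F)"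
    proof (intro Set.set_eqI iffI)
      fix u assume "u \<in> Q.line_extension ?K (?h (monomial a)) ?E"
      then obtain c f where "f \<in> supported_on F"
        and u: "u = ?h (Poly_Mapping.single a c + f)"
        by (auto simp: Q.line_extension_mem_iff h_add h_mult constant_poly_def monomial_def
            mult_single)
      then have "Poly_Mapping.single a c + f \<in> supported_on (insert a F)"
        using keys_add[of "Poly_Mapping.single a c" f]
        by (auto simp: supported_on_def split: if_splits)
      with u show "u \<in> ?h ` supported_on (insert a F)" by blast
    next
      fix u assume "u \<in> ?h ` supported_on (insert a F)"
      then obtain g where g: "g \<in> supported_on (insert a F)" "u = ?h g" by blast
      let ?c = "Poly_Mapping.lookup g a"
      have "g - Poly_Mapping.single a ?c \<in> supported_on F"
        using g(1) by (auto simp: supported_on_def in_keys_iff lookup_minus lookup_single when_def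
            split: if_splits)
      moreover have "u = ?h (constant_poly ?c) \<otimes>\<^bsub>?R Quot ?J\<^esub> ?h (monomial a)
          \<oplus>\<^bsub>?R Quot ?J\<^esub> ?h (g - Poly_Mapping.single a ?c)"
        by (simp add: h_add h_mult constant_poly_def monomial_def mult_single g(2))
      ultimately show "u \<in> Q.line_extension ?K (?h (monomial a)) ?E"
        unfolding Q.line_extension_mem_iff by blast
    qed
    ultimately show ?case
      using Q.Suc_dim[OF h_closed, of "monomial a" ?E "card F" ?K] insert by simp
  qed
  let ?F = "{a. total_deg a = d \<and> a \<notin> A}"
  have "?h ` homogeneous_polys d = ?h ` supported_on ?F"
  proof
    show "?h ` supported_on ?F \<subseteq> ?h ` homogeneous_polys d"
      by (rule image_mono) (auto simp: supported_on_def homogeneous_polys_def)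
    show "?h ` homogeneous_polys d \<subseteq> ?h ` supported_on ?F"
    proof (rule image_subsetI)
      fix f :: "('n, 'k) mpoly"
      assume "f \<in> homogeneous_polys d"
      then have "f \<in> supported_on (?F \<union> A)"
        by (auto simp: supported_on_def homogeneous_polys_def)
      then obtain g j where "g \<in> supported_on ?F" "j \<in> ?J" "f = g + j"
        unfolding set_add_supported_on[symmetric] set_add_def' by auto
      moreover from this have "?h f = ?h g"
        by (simp add: h_eq_iff)
      ultimately show "?h f \<in> ?h ` supported_on ?F" by blast
    qed
  qed
  moreover have "Q.dimension (card ?F) ?K (?h ` supported_on ?F)"
    using fin by (rule dimension) auto
  ultimately show ?thesis
    using Q.dimI[OF K] by (simp add: graded_quotient_dim_def over_def)
qed

section \<open>Counting divisors\<close>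

lemma bij_betw_lookup:
  "bij_betw Poly_Mapping.lookup {a :: 'n::finite \<Rightarrow>\<^sub>0 'b::zero. P (Poly_Mapping.lookup a)} {f. P f}"
  by (rule bij_betwI[where g = Abs_poly_mapping]) (auto simp: lookup_inverse)

text \<open>
  Divisibility of monomials is comparison of exponents in each coordinate, so the divisors of a
  monomial form a box of lattice points.
\<close>

lemma dvd_exponent_iff:
  "(\<exists>c. a = b + c) \<longleftrightarrow> (\<forall>i. Poly_Mapping.lookup b i \<le> Poly_Mapping.lookup a i)"
  for a b :: "'n \<Rightarrow>\<^sub>0 nat"
proof
  assume "\<forall>i. Poly_Mapping.lookup b i \<le> Poly_Mapping.lookup a i"
  then have "a = b + (a - b)"
    by (intro poly_mapping_eqI) (simp add: lookup_add lookup_minus)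
  then show "\<exists>c. a = b + c" ..
qed (auto simp: lookup_add)

lemma finite_total_deg_le: "finite {a :: 'n::finite \<Rightarrow>\<^sub>0 nat. total_deg a \<le> D}"
proof -
  have "finite (UNIV \<rightarrow>\<^sub>E {..D} :: ('n \<Rightarrow> nat) set)"
    by (rule finite_PiE) auto
  then have "finite {f :: 'n \<Rightarrow> nat. (\<Sum>i\<in>UNIV. f i) \<le> D}"
  proof (rule rev_finite_subset, intro subsetI PiE_I)
    fix f :: "'n \<Rightarrow> nat" and i
    assume "f \<in> {f. (\<Sum>i\<in>UNIV. f i) \<le> D}"
    then show "f i \<in> {..D}"
      using member_le_sum[of i UNIV f] by simp
  qed simp
  then show ?thesis
    unfolding total_deg_def
    by (rule bij_betw_finite[OF bij_betw_lookup[of "\<lambda>f. (\<Sum>i\<in>UNIV. f i) \<le> D"], THEN iffD2])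
qed

lemma divisors_finite_card:
  fixes a :: "'n::finite \<Rightarrow>\<^sub>0 nat"
  shows "finite {b. \<exists>c. a = b + c}"
    and "card {b. \<exists>c. a = b + c} = (\<Prod>i\<in>UNIV. Poly_Mapping.lookup a i + 1)"
proof -
  have bij: "bij_betw Poly_Mapping.lookup {b. \<exists>c. a = b + c}
      (\<Pi>\<^sub>E i\<in>UNIV. {..Poly_Mapping.lookup a i})"
    using bij_betw_lookup[of "\<lambda>f. \<forall>i. f i \<le> Poly_Mapping.lookup a i"]
    by (simp add: dvd_exponent_iff PiE_UNIV_domain Pi_def)
  show "finite {b. \<exists>c. a = b + c}"
    using bij_betw_finite[OF bij] finite_PiE by (metis finite finite_atMost)
  show "card {b. \<exists>c. a = b + c} = (\<Prod>i\<in>UNIV. Poly_Mapping.lookup a i + 1)"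
    using bij_betw_same_card[OF bij] by (simp add: card_PiE)
qed

lemma card_nonzero_divisors:
  fixes a :: "'n::finite \<Rightarrow>\<^sub>0 nat"
  shows "Suc (card {b. b \<noteq> 0 \<and> (\<exists>c. a = b + c)}) = (\<Prod>i\<in>UNIV. Poly_Mapping.lookup a i + 1)"
proof -
  have "{b. \<exists>c. a = b + c} = insert 0 {b. b \<noteq> 0 \<and> (\<exists>c. a = b + c)}"
    by auto
  moreover have "finite {b. b \<noteq> 0 \<and> (\<exists>c. a = b + c)}"
    using divisors_finite_card(1)[of a] by (rule rev_finite_subset) auto
  ultimately show ?thesis
    using divisors_finite_card(2)[of a] by simp
qed

section \<open>The expected Hilbert function\<close>

lemma inj_monomial: "inj (monomial :: _ \<Rightarrow> ('n, 'k::field) mpoly)"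
proof (rule injI)
  fix a b :: "'n \<Rightarrow>\<^sub>0 nat"
  assume "(monomial a :: ('n, 'k) mpoly) = monomial b"
  then have "Poly_Mapping.keys (monomial a :: ('n, 'k) mpoly) =
      Poly_Mapping.keys (monomial b :: ('n, 'k) mpoly)"
    by simp
  then show "a = b"
    by (simp add: monomial_def)
qed

lemma finite_candidate_monomials:
  "finite (candidate_monomials D :: ('n::finite, 'k::field) mpoly set)"
  unfolding candidate_monomials_def
  by (intro finite_imageI finite_subset[OF _ finite_total_deg_le[of D]]) auto

text \<open>
  Here \<open>s\<close> is an outcome of the random choice. In degree \<open>d \<le> D\<close> the ideal power contributes
  nothing and the degree bound on generators holds for every divisor, so \<open>D\<close> disappears from
  the description of the standard monomials.
\<close>

lemma graded_quotient_dim_truncated: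
  fixes s :: "('n::finite, 'k::field) mpoly \<Rightarrow> bool"
  assumes "d \<le> D"
  shows "graded_quotient_dim
      (genideal mpoly_ring {m \<in> candidate_monomials D. s m}
        <+>\<^bsub>mpoly_ring\<^esub> ideal_pow irrelevant_ideal (D + 1)) d =
    card {a. total_deg a = d \<and> (\<forall>b. b \<noteq> 0 \<and> (\<exists>c. a = b + c) \<longrightarrow> \<not> s (monomial b))}"
proof -
  let ?B = "{b. b \<noteq> 0 \<and> total_deg b \<le> D \<and> s (monomial b)}"
  let ?A = "multiples ?B \<union> {a. D + 1 \<le> total_deg a}"
  have "{m \<in> candidate_monomials D. s m} = monomial ` ?B"
    by (auto simp: candidate_monomials_def)
  then have "genideal mpoly_ring {m \<in> candidate_monomials D. s m}
      <+>\<^bsub>mpoly_ring\<^esub> ideal_pow irrelevant_ideal (D + 1) = supported_on ?A"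
    by (simp only: genideal_monomials ideal_pow_irrelevant_ideal set_add_supported_on)
  moreover have "add_closed ?A"
    using add_closed_multiples[of ?B] add_closed_total_deg_ge[of "D + 1"]
    unfolding add_closed_def by blast
  moreover have "0 \<notin> ?A"
  proof -
    have "b + c \<noteq> 0" if "b \<noteq> 0" for b c :: "'n \<Rightarrow>\<^sub>0 nat"
      using that by (simp add: total_deg_add flip: total_deg_eq_0_iff)
    then show ?thesis
      by (auto simp: multiples_def total_deg_def)
  qed
  moreover have "{a. total_deg a = d \<and> a \<notin> ?A} =
      {a. total_deg a = d \<and> (\<forall>b. b \<noteq> 0 \<and> (\<exists>c. a = b + c) \<longrightarrow> \<not> s (monomial b))}" (is "_ = ?F")
  proof -
    have "total_deg b \<le> D" if "total_deg (b + c) = d" for b c :: "'n \<Rightarrow>\<^sub>0 nat"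
      using that assms by (simp add: total_deg_add)
    then show ?thesis
      using assms unfolding multiples_def by auto
  qed
  moreover have "finite ?F"
    by (rule finite_subset[OF _ finite_total_deg_le[of d]]) auto
  ultimately show ?thesis
    using graded_quotient_dim_supported_on[of ?A d, where ?'k = 'k] by simp
qed

lemma prob_all_excluded:
  assumes "finite C" "N \<subseteq> C" "0 \<le> p" "p \<le> 1"
  shows "measure_pmf.prob (Pi_pmf C False (\<lambda>_. bernoulli_pmf p)) {s. \<forall>m\<in>N. \<not> s m} =
    (1 - p) ^ card N"
proof -
  \<comment> \<open>The event is a product event, constraining only the coordinates in \<open>N\<close>.\<close>
  let ?X = "\<lambda>m. if m \<in> N then {False} else UNIV"
  have "{s. \<forall>m\<in>N. \<not> s m} = Pi C ?X"
    using assms(2) by (auto simp: Pi_def)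
  then have "measure_pmf.prob (Pi_pmf C False (\<lambda>_. bernoulli_pmf p)) {s. \<forall>m\<in>N. \<not> s m} =
      (\<Prod>m\<in>C. measure_pmf.prob (bernoulli_pmf p) (?X m))"
    using assms(1) by (simp only: measure_Pi_pmf_Pi)
  also have "\<dots> = (\<Prod>m\<in>C. if m \<in> N then 1 - p else 1)"
    using assms(3,4) by (intro prod.cong) (auto simp: measure_pmf_single)
  also have "\<dots> = (1 - p) ^ card N"
    using assms(1,2) by (simp add: prod.If_cases Int_absorb1)
  finally show ?thesis .
qed

text \<open>
  The factor \<open>inverse (1 - p)\<close> accounts for the divisor \<open>1\<close>, which is never a candidate generator.
\<close>

lemma prob_standard_monomial:
  fixes a :: "'n::finite \<Rightarrow>\<^sub>0 nat"
  assumes "total_deg a \<le> D" "0 \<le> p" "p < 1"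
  shows "measure_pmf.prob
      (Pi_pmf (candidate_monomials D :: ('n, 'k::field) mpoly set) False (\<lambda>_. bernoulli_pmf p))
      {s. \<forall>b. b \<noteq> 0 \<and> (\<exists>c. a = b + c) \<longrightarrow> \<not> s (monomial b)} =
    inverse (1 - p) * (1 - p) ^ (\<Prod>i\<in>UNIV. Poly_Mapping.lookup a i + 1)"
proof -
  let ?N = "{b. b \<noteq> 0 \<and> (\<exists>c. a = b + c)}"
  have eq: "{s. \<forall>b. b \<noteq> 0 \<and> (\<exists>c. a = b + c) \<longrightarrow> \<not> s (monomial b)} =
      {s :: ('n, 'k) mpoly \<Rightarrow> bool. \<forall>m\<in>monomial ` ?N. \<not> s m}"
    by auto
  have sub: "(monomial ` ?N :: ('n, 'k) mpoly set) \<subseteq> candidate_monomials D"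
    using assms(1) by (auto simp: candidate_monomials_def total_deg_add)
  have "card (monomial ` ?N :: ('n, 'k) mpoly set) = card ?N"
    by (rule card_image) (rule inj_on_subset[OF inj_monomial subset_UNIV])
  with prob_all_excluded[OF finite_candidate_monomials sub, of p] assms(2,3)
  have "measure_pmf.prob
      (Pi_pmf (candidate_monomials D :: ('n, 'k) mpoly set) False (\<lambda>_. bernoulli_pmf p))
      {s. \<forall>m\<in>monomial ` ?N. \<not> s m} = (1 - p) ^ card ?N"
    by simp
  then show ?thesis
    unfolding eq card_nonzero_divisors[symmetric] using assms(3) by simp
qed

text \<open>
  Linearity of expectation applied to the cardinality as a sum of indicators.
\<close>

lemma expectation_card_filter:
  fixes M :: "'s pmf"
  assumes "finite F"
  shows "measure_pmf.expectation M (\<lambda>s. real (card {a \<in> F. Q s a})) =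
    (\<Sum>a\<in>F. measure_pmf.prob M {s. Q s a})"
proof -
  have "real (card {a \<in> F. Q s a}) = (\<Sum>a\<in>F. indicator {s. Q s a} s)" for s
    using assms by (simp add: indicator_def sum.If_cases Int_def)
  then have "measure_pmf.expectation M (\<lambda>s. real (card {a \<in> F. Q s a})) =
      measure_pmf.expectation M (\<lambda>s. \<Sum>a\<in>F. indicator {s. Q s a} s)"
    by simp
  also have "\<dots> = (\<Sum>a\<in>F. measure_pmf.expectation M (indicator {s. Q s a}))"
    by (rule Bochner_Integration.integral_sum)
      (auto intro: measure_pmf.integrable_const_bound[where B = 1])
  finally show ?thesis by simp
qed

theorem corollary3p6:
  fixes D d :: nat and p q :: real
  assumes "infinite (UNIV :: 'k::field set)"
    and "D \<ge> 1" and "0 \<le> p" and "p < 1" and "q = 1 - p"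
    and "1 < d" and "d \<le> D"
  shows "measure_pmf.expectation (ER_monomial_ideal D p :: ('n::finite, 'k) mpoly set pmf)
           (\<lambda>I. real (graded_quotient_dim
                        (I <+>\<^bsub>mpoly_ring\<^esub> ideal_pow irrelevant_ideal (D + 1)) d))
         = inverse q * (\<Sum>a | (\<Sum>i\<in>UNIV. a i) = d. q ^ (\<Prod>i\<in>UNIV. (a (i :: 'n) :: nat) + 1))"
proof -
  let ?M = "Pi_pmf (candidate_monomials D :: ('n, 'k) mpoly set) False (\<lambda>_. bernoulli_pmf p)"
  let ?F = "{a :: 'n \<Rightarrow>\<^sub>0 nat. total_deg a = d}"
  let ?Q = "\<lambda>s a. \<forall>b. b \<noteq> 0 \<and> (\<exists>c. a = b + c) \<longrightarrow> \<not> s (monomial b :: ('n, 'k) mpoly)"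
  have fin: "finite ?F"
    by (rule finite_subset[OF _ finite_total_deg_le[of d]]) auto
  have "measure_pmf.expectation (ER_monomial_ideal D p :: ('n, 'k) mpoly set pmf)
      (\<lambda>I. real (graded_quotient_dim
        (I <+>\<^bsub>mpoly_ring\<^esub> ideal_pow irrelevant_ideal (D + 1)) d)) =
    measure_pmf.expectation ?M (\<lambda>s. real (card {a \<in> ?F. ?Q s a}))"
    unfolding ER_monomial_ideal_def random_monomials_def integral_map_pmf
      graded_quotient_dim_truncated[OF \<open>d \<le> D\<close>] by simp
  also have "\<dots> = (\<Sum>a\<in>?F. measure_pmf.prob ?M {s. ?Q s a})"
    using fin by (rule expectation_card_filter)
  also have "\<dots> = (\<Sum>a\<in>?F. inverse q * q ^ (\<Prod>i\<in>UNIV. Poly_Mapping.lookup a i + 1))"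
    using assms by (intro sum.cong refl) (simp add: prob_standard_monomial del: all_simps imp_conjL)
  also have "\<dots> = inverse q * (\<Sum>a\<in>?F. q ^ (\<Prod>i\<in>UNIV. Poly_Mapping.lookup a i + 1))"
    by (simp add: sum_distrib_left)
  also have "(\<Sum>a\<in>?F. q ^ (\<Prod>i\<in>UNIV. Poly_Mapping.lookup a i + 1)) =
      (\<Sum>a | (\<Sum>i\<in>UNIV. a i) = d. q ^ (\<Prod>i\<in>UNIV. (a (i :: 'n) :: nat) + 1))"
    using sum.reindex_bij_betw[OF bij_betw_lookup[of "\<lambda>f. (\<Sum>i\<in>UNIV. f i) = d"],
        of "\<lambda>f. q ^ (\<Prod>i\<in>UNIV. f i + 1)"]
    by (simp add: total_deg_def)
  finally show ?thesis .
qed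

end
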